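(* Let $t, r, s$ be integers with $1 \leq t \leq r \leq s$, and let \[c(r,s,t) = r + (s-t)\max \left\{2{s \choose t}, \; 2^r(r-t){r \choose t} + 1 \right\}.\] Let $\mathcal{H}$ be a hereditary family with $\mu(\mathcal{H}) \geq c(r,s,t)$, and let $(\mathcal{A}, \mathcal{B}) \in M(\mathcal{H}^{(r)},\mathcal{H}^{(s)},t)$. Then there is a set $I \in \mathcal{H}$ with $t \leq |I| \leq r$ such that either \[\mathcal{A} = \mathcal{H}^{(r)}(I) \text{ and } \mathcal{B} = \{B \in \mathcal{H}^{(s)} \colon |B \cap I| \geq t\},\] or \[r = s,\ t < |I|,\ \mathcal{A} = \{A \in \mathcal{H}^{(r)} \colon |A \cap I| \geq t\}, \text{ and } \mathcal{B} = \mathcal{H}^{(s)}(I).\]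
   Context: All sets and families (sets of sets) are finite. A family $\mathcal{H}$ is hereditary if for every $A \in \mathcal{H}$, every subset of $A$ is in $\mathcal{H}$. For a family $\mathcal{F}$, $\mathcal{F}^{(r)}$ denotes the family of $r$-element sets in $\mathcal{F}$. A set $B \in \mathcal{F}$ is a base of $\mathcal{F}$ if $B$ is not a proper subset of any $A \in \mathcal{F}$; $\mu(\mathcal{F})$ is the size of a smallest base of $\mathcal{F}$. For a family $\mathcal{F}$ and a set $T$, $\mathcal{F}(T) = \{A \in \mathcal{F} \colon T \subseteq A\}$. A set $A$ $t$-intersects a set $B$ if $|A \cap B| \geq t$; families $\mathcal{A}, \mathcal{B}$ are cross-$t$-intersecting if every set in $\mathcal{A}$ $t$-intersects every set in $\mathcal{B}$. For families $\mathcal{F}, \mathcal{G}$: $C(\mathcal{F},\mathcal{G},t)$ is the set of pairs $(\mathcal{A},\mathcal{B})$ with $\emptyset \neq \mathcal{A} \subseteq \mathcal{F}$, $\emptyset \neq \mathcal{B} \subseteq \mathcal{G}$, and $\mathcal{A},\mathcal{B}$ cross-$t$-intersecting; $m(\mathcal{F},\mathcal{G},t) = \max\{|\mathcal{A}|+|\mathcal{B}| \colon (\mathcal{A},\mathcal{B}) \in C(\mathcal{F},\mathcal{G},t)\}$; and $M(\mathcal{F},\mathcal{G},t)$ is the set of pairs in $C(\mathcal{F},\mathcal{G},t)$ with $|\mathcal{A}|+|\mathcal{B}| = m(\mathcal{F},\mathcal{G},t)$. *)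

theory Defs
  imports Complex_Main
begin

text \<open>
  Families are of type \<open>'a set set\<close>. All sets and families are meant to be finite; finiteness is
  not built into the definitions and has to be assumed wherever they are used, since \<open>card\<close> is 0 on
  infinite sets and \<open>Max\<close>, \<open>Min\<close> are unspecified on infinite sets.
\<close>

definition hereditary :: "'a set set \<Rightarrow> bool" where
  "hereditary H \<longleftrightarrow> (\<forall>A\<in>H. \<forall>B. B \<subseteq> A \<longrightarrow> B \<in> H)"

definition level :: "'a set set \<Rightarrow> nat \<Rightarrow> 'a set set" where
  "level F r = {A \<in> F. card A = r}"

definition bases :: "'a set set \<Rightarrow> 'a set set" where
  "bases F = {B \<in> F. \<not> (\<exists>A\<in>F. B \<subset> A)}"

text \<open>The size of a smallest base; unspecified for the empty family, which has no base.\<close>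

definition min_base_size :: "'a set set \<Rightarrow> nat" where
  "min_base_size F = Min (card ` bases F)"

definition star :: "'a set set \<Rightarrow> 'a set \<Rightarrow> 'a set set" where
  "star F T = {A \<in> F. T \<subseteq> A}"

definition intersects_in :: "nat \<Rightarrow> 'a set \<Rightarrow> 'a set \<Rightarrow> bool" where
  "intersects_in t A B \<longleftrightarrow> t \<le> card (A \<inter> B)"

definition cross_intersecting :: "nat \<Rightarrow> 'a set set \<Rightarrow> 'a set set \<Rightarrow> bool" where
  "cross_intersecting t \<A> \<B> \<longleftrightarrow> (\<forall>A\<in>\<A>. \<forall>B\<in>\<B>. intersects_in t A B)"

text \<open>The next three definitions are written $C(F,G,t)$, $m(F,G,t)$ and $M(F,G,t)$.\<close>

definition cross_pairs :: "'a set set \<Rightarrow> 'a set set \<Rightarrow> nat \<Rightarrow> ('a set set \<times> 'a set set) set" where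
  "cross_pairs F G t =
     {(\<A>, \<B>). \<A> \<noteq> {} \<and> \<A> \<subseteq> F \<and> \<B> \<noteq> {} \<and> \<B> \<subseteq> G \<and> cross_intersecting t \<A> \<B>}"

definition max_cross_sum :: "'a set set \<Rightarrow> 'a set set \<Rightarrow> nat \<Rightarrow> nat" where
  "max_cross_sum F G t = Max {card \<A> + card \<B> | \<A> \<B>. (\<A>, \<B>) \<in> cross_pairs F G t}"

definition max_cross_pairs :: "'a set set \<Rightarrow> 'a set set \<Rightarrow> nat \<Rightarrow> ('a set set \<times> 'a set set) set" where
  "max_cross_pairs F G t =
     {(\<A>, \<B>). (\<A>, \<B>) \<in> cross_pairs F G t \<and> card \<A> + card \<B> = max_cross_sum F G t}"

text \<open>Used only for \<open>t \<le> r \<le> s\<close>, so the natural-number subtractions do not truncate.\<close>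

definition c_bound :: "nat \<Rightarrow> nat \<Rightarrow> nat \<Rightarrow> nat" where
  "c_bound r s t =
     r + (s - t) * max (2 * (s choose t)) (2 ^ r * (r - t) * (r choose t) + 1)"

end

theory Submission
  imports Defs
begin

text \<open>
  For a \<open>t\<close>-set \<open>T\<close> let $d(T) = |H^{(s)}(T)|$. Counting pairs of a set and a one-element extension
  of it shows that, when all bases of \<open>H\<close> are large, $|H^{(s)}(T \cup \{w\})|$ and (for $r < s$)
  $|H^{(r)}(T)|$ are tiny compared with $d(T)$.

  Let $I = \bigcap \mathcal{A}$. If every $B \in \mathcal{B}$ satisfies $|B \cap I| \geq t$, then
  maximality gives the first form. Otherwise fix $B_0 \in \mathcal{B}$ with $|B_0 \cap I| < t$. Each
  member of $\mathcal{A}$ contains a \<open>t\<close>-set $T \subseteq B_0$, and $T \not\subseteq I$. For such \<open>T\<close>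
  and $T \subseteq A_0 \in \mathcal{A}$, some $A' \in \mathcal{A}$ does not contain \<open>T\<close>, so members
  of $\mathcal{B}$ that contain \<open>T\<close> contain a further element of $A'$ and are few. Replacing
  $\mathcal{A}$ by $\{A_0\}$ and $\mathcal{B}$ by all sets that \<open>t\<close>-intersect $A_0$ hence gains
  nearly $d(T)$ sets, and maximality bounds $d(T)$ by about $|\mathcal{A}|$. So if the sets of
  $\mathcal{A}$ containing \<open>T\<close> are few compared with $d(T)$, summing over \<open>T\<close> gives
  $|\mathcal{A}| < |\mathcal{A}|$. This is automatic for $r < s$; for $r = s$ it holds for
  $\mathcal{A}$ or, with the roles exchanged, for $\mathcal{B}$, unless the second form occurs.
\<close>

section \<open>Star sizes in a hereditary family with large bases\<close>

lemma subset_base: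
  assumes "finite H" "F \<in> H"
  obtains U where "U \<in> bases H" "F \<subseteq> U"
proof -
  obtain U where U: "U \<in> H" "F \<subseteq> U" "\<forall>V\<in>H. U \<subseteq> V \<longrightarrow> U = V"
    using finite_has_maximal2[OF assms] by metis
  then have "U \<in> bases H" unfolding bases_def by blast
  with U show ?thesis using that by blast
qed

text \<open>Double counting of pairs (F, x) with x outside F and \<open>insert x F\<close> in
  \<open>H\<close>. A base U containing F supplies at least m - k such x, since heredity admits
  every x in U - F; conversely, a set of size k + 1 arises only by adding back one of its elements
  outside \<open>X\<close>.\<close>

lemma star_level_Suc:
  assumes fin: "finite H" "\<forall>A\<in>H. finite A" and her: "hereditary H"
    and base: "\<forall>U\<in>bases H. m \<le> card U" and X: "finite X"
  shows "(m - k) * card (star (level H k) X) \<le> (Suc k - card X) * card (star (level H (Suc k)) X)"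
proof -
  let ?P = "star (level H k) X" and ?Q = "star (level H (Suc k)) X"
  let ?E = "\<lambda>F. {x. x \<notin> F \<and> insert x F \<in> H}"
  have finP: "finite ?P" and finQ: "finite ?Q"
    using fin unfolding star_def level_def by auto
  have "finite (\<Union>H)" using fin by blast
  then have finE: "finite (?E F)" for F by (rule rev_finite_subset) blast
  have ext: "m - k \<le> card (?E F)" if "F \<in> ?P" for F
  proof -
    have F: "F \<in> H" "card F = k" using that unfolding star_def level_def by auto
    obtain U where U: "U \<in> bases H" "F \<subseteq> U" using subset_base[OF fin(1) F(1)] .
    have UH: "U \<in> H" using U(1) unfolding bases_def by blast
    have "m - k \<le> card U - card F" using base U(1) F(2) by auto
    also have "\<dots> \<le> card (U - F)" using fin F(1) by (intro diff_card_le_card_Diff) auto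
    also have "\<dots> \<le> card (?E F)"
      using her UH U(2) unfolding hereditary_def by (intro card_mono finE) blast
    finally show ?thesis .
  qed
  have "(m - k) * card ?P = (\<Sum>F\<in>?P. m - k)" by simp
  also have "\<dots> \<le> (\<Sum>F\<in>?P. card (?E F))" by (rule sum_mono) (rule ext)
  also have "\<dots> = card (Sigma ?P ?E)" using finP finE by simp
  also have "\<dots> \<le> card (Sigma ?Q (\<lambda>F. F - X))"
  proof (rule card_inj_on_le[where f = "\<lambda>(F, x). (insert x F, x)"])
    show "inj_on (\<lambda>(F, x). (insert x F, x)) (Sigma ?P ?E)"
      by (auto simp: inj_on_def dest: insert_ident[THEN iffD1, rotated -1])
    show "(\<lambda>(F, x). (insert x F, x)) ` Sigma ?P ?E \<subseteq> Sigma ?Q (\<lambda>F. F - X)"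
      using fin by (auto simp: star_def level_def)
    show "finite (Sigma ?Q (\<lambda>F. F - X))"
      using finQ fin by (auto simp: star_def level_def)
  qed
  also have "\<dots> = (\<Sum>F\<in>?Q. card (F - X))"
    using finQ fin by (intro card_SigmaI) (auto simp: star_def level_def)
  also have "\<dots> = (\<Sum>F\<in>?Q. Suc k - card X)"
    using X by (intro sum.cong) (auto simp: star_def level_def card_Diff_subset)
  finally show ?thesis by (simp add: mult.commute)
qed

text \<open>Deleting \<open>w\<close> is injective on sets containing it. Combined with
  \<open>star_level_Suc\<close>, this shows that prescribing one further element shrinks a star by a
  large factor.\<close>

lemma star_level_insert:
  assumes fin: "finite H" "\<forall>A\<in>H. finite A" and her: "hereditary H" and w: "w \<notin> X"
  shows "card (star (level H (Suc k)) (insert w X)) \<le> card (star (level H k) X)"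
proof (rule card_inj_on_le[where f = "\<lambda>F. F - {w}"])
  show "inj_on (\<lambda>F. F - {w}) (star (level H (Suc k)) (insert w X))"
    by (auto simp: inj_on_def star_def)
  show "(\<lambda>F. F - {w}) ` star (level H (Suc k)) (insert w X) \<subseteq> star (level H k) X"
    using her w fin by (auto simp: star_def level_def hereditary_def)
  show "finite (star (level H k) X)" using fin by (simp add: star_def level_def)
qed

text \<open>Below level \<open>card X\<close> stars are empty; from there on, the bound on
  \<open>2 * j\<close> makes the left factor in \<open>star_level_Suc\<close> positive and at least
  as large as the right one.\<close>

lemma star_level_mono:
  assumes fin: "finite H" "\<forall>A\<in>H. finite A" and her: "hereditary H"
    and base: "\<forall>U\<in>bases H. m \<le> card U" and X: "finite X"
    and "i \<le> j" "2 * j \<le> m + card X"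
  shows "card (star (level H i) X) \<le> card (star (level H j) X)"
  using assms(6,7)
proof (induction j rule: dec_induct)
  case base
  show ?case by simp
next
  case (step k)
  show ?case
  proof (cases "card X \<le> k")
    case True
    have "(m - k) * card (star (level H k) X) \<le> (Suc k - card X) * card (star (level H (Suc k)) X)"
      by (rule star_level_Suc[OF fin her base X])
    also have "\<dots> \<le> (m - k) * card (star (level H (Suc k)) X)"
      using step.prems by (intro mult_right_mono) auto
    finally have "card (star (level H k) X) \<le> card (star (level H (Suc k)) X)"
      using step.prems True by auto
    then show ?thesis using step by auto
  next
    case False
    have "i < card F" if "F \<in> H" "X \<subseteq> F" for F
      using False step.hyps fin card_mono[of F X] that by auto
    then have "star (level H i) X = {}" by (auto simp: star_def level_def)
    then show ?thesis by simp
  qed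
qed

text \<open>As \<open>T\<close> meets \<open>E\<close> in fewer than t elements, E - T contains a
  set W of |E| - t + 1 elements. Only t - 1 elements of \<open>E\<close> lie outside W, so every
  member of \<open>P\<close> hits W. Hence |W| stars cover \<open>P\<close>, each at most 1/N of the
  star of \<open>T\<close>.\<close>

lemma card_star_meeting:
  assumes fin: "finite H" and T: "finite T" "card T = t"
    and E: "finite E" "t \<le> card E" "\<not> T \<subseteq> E"
    and P: "P \<subseteq> star (level H k) T" "\<forall>F\<in>P. t \<le> card (F \<inter> E)"
    and small: "\<And>w. w \<notin> T \<Longrightarrow>
      N * card (star (level H k) (insert w T)) \<le> card (star (level H k) T)"
  shows "N * card P \<le> Suc (card E - t) * card (star (level H k) T)"
proof -
  let ?S = "\<lambda>X. star (level H k) X"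
  have "card (T \<inter> E) < t"
    using psubset_card_mono[of T "T \<inter> E"] T E(3) by auto
  then have "Suc (card E - t) \<le> card (E - T)"
    using E card_Diff_subset_Int[of E T] T by (simp add: Int_commute)
  then obtain W where W: "W \<subseteq> E - T" "card W = Suc (card E - t)" "finite W"
    by (rule obtain_subset_with_card_n)
  have "P \<subseteq> (\<Union>w\<in>W. ?S (insert w T))"
  proof
    fix F assume F: "F \<in> P"
    have "F \<inter> W \<noteq> {}"
    proof
      assume "F \<inter> W = {}"
      then have "card (F \<inter> E) \<le> card (E - W)" using E by (intro card_mono) auto
      also have "\<dots> = card E - card W" using W by (intro card_Diff_subset) auto
      also have "\<dots> < t" using W E \<open>card (T \<inter> E) < t\<close> by auto
      finally show False using P(2) F by auto
    qed
    then show "F \<in> (\<Union>w\<in>W. ?S (insert w T))"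
      using F P(1) by (auto simp: star_def)
  qed
  moreover have "finite (\<Union>w\<in>W. ?S (insert w T))"
    using fin W by (auto simp: star_def level_def)
  ultimately have "card P \<le> card (\<Union>w\<in>W. ?S (insert w T))" by (rule card_mono[rotated])
  also have "\<dots> \<le> (\<Sum>w\<in>W. card (?S (insert w T)))" by (rule card_UN_le[OF W(3)])
  finally have "card P \<le> (\<Sum>w\<in>W. card (?S (insert w T)))" .
  then have "N * card P \<le> N * (\<Sum>w\<in>W. card (?S (insert w T)))" by simp
  also have "\<dots> = (\<Sum>w\<in>W. N * card (?S (insert w T)))" by (rule sum_distrib_left)
  also have "\<dots> \<le> (\<Sum>w\<in>W. card (?S T))" using W small by (intro sum_mono) auto
  finally show ?thesis using W by simp
qed

section \<open>Pairs of maximum sum and their comparison with other cross-intersecting pairs\<close>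

text \<open>Unlike \<^const>\<open>max_cross_pairs\<close>, this is symmetric on its face, which serves the case \<open>r = s\<close>.\<close>

definition optimal_pair ::
    "'a set set \<Rightarrow> 'a set set \<Rightarrow> nat \<Rightarrow> 'a set set \<Rightarrow> 'a set set \<Rightarrow> bool" where
  "optimal_pair F G t \<A> \<B> \<longleftrightarrow> (\<A>, \<B>) \<in> cross_pairs F G t \<and>
     (\<forall>(\<A>', \<B>')\<in>cross_pairs F G t. card \<A>' + card \<B>' \<le> card \<A> + card \<B>)"

lemma cross_pairs_swap: "(\<A>, \<B>) \<in> cross_pairs F G t \<Longrightarrow> (\<B>, \<A>) \<in> cross_pairs G F t"
  by (simp add: cross_pairs_def cross_intersecting_def intersects_in_def)
    (metis Int_commute)

lemma optimal_pair_swap: "optimal_pair F G t \<A> \<B> \<Longrightarrow> optimal_pair G F t \<B> \<A>"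
  unfolding optimal_pair_def Ball_def split_paired_All prod.case
  by (metis add.commute cross_pairs_swap)

lemma optimal_pair_max_cross_pairs:
  assumes "finite F" "finite G" "(\<A>, \<B>) \<in> max_cross_pairs F G t"
  shows "optimal_pair F G t \<A> \<B>"
proof -
  let ?S = "{card \<A> + card \<B> | \<A> \<B>. (\<A>, \<B>) \<in> cross_pairs F G t}"
  have "?S \<subseteq> (\<lambda>(\<A>, \<B>). card \<A> + card \<B>) ` (Pow F \<times> Pow G)"
    by (auto simp: cross_pairs_def)
  then have "finite ?S" using assms(1,2) finite_subset by blast
  then have "card \<A>' + card \<B>' \<le> max_cross_sum F G t" if "(\<A>', \<B>') \<in> cross_pairs F G t" for \<A>' \<B>'
    unfolding max_cross_sum_def using that by (intro Max_ge) auto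
  then show ?thesis using assms(3) by (auto simp: optimal_pair_def max_cross_pairs_def)
qed

text \<open>The right-hand families contain the given ones and still cross-intersect, because A
  \<inter> B contains B \<inter> I; maximality forces equality. Applied to the swapped pair, this
  yields the second form of the theorem.\<close>

lemma optimal_pair_kernel:
  assumes fin: "finite H" "\<forall>A\<in>H. finite A"
    and opt: "optimal_pair (level H r) (level H s) t \<A> \<B>"
    and I: "\<forall>A\<in>\<A>. I \<subseteq> A" "\<forall>B\<in>\<B>. t \<le> card (B \<inter> I)"
  shows "\<A> = star (level H r) I \<and> \<B> = {B \<in> level H s. t \<le> card (B \<inter> I)}"
proof -
  let ?A = "star (level H r) I" and ?B = "{B \<in> level H s. t \<le> card (B \<inter> I)}"
  have cp: "(\<A>, \<B>) \<in> cross_pairs (level H r) (level H s) t"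
    using opt by (simp add: optimal_pair_def)
  then have sub: "\<A> \<subseteq> ?A" "\<B> \<subseteq> ?B" using I by (auto simp: cross_pairs_def star_def)
  have "t \<le> card (A \<inter> B)" if "A \<in> ?A" "B \<in> ?B" for A B
  proof -
    have "card (B \<inter> I) \<le> card (A \<inter> B)"
      using that fin by (intro card_mono) (auto simp: star_def level_def)
    then show ?thesis using that by simp
  qed
  then have "(?A, ?B) \<in> cross_pairs (level H r) (level H s) t"
    using cp sub by (auto simp: cross_pairs_def cross_intersecting_def intersects_in_def star_def)
  then have le: "card ?A + card ?B \<le> card \<A> + card \<B>"
    using opt by (auto simp: optimal_pair_def)
  have finAB: "finite ?A" "finite ?B" using fin by (auto simp: star_def level_def)
  have "card \<A> \<le> card ?A" "card \<B> \<le> card ?B" using sub finAB by (auto intro: card_mono)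
  with le have "card \<A> = card ?A" "card \<B> = card ?B" by linarith+
  then show ?thesis using sub finAB by (simp add: card_subset_eq)
qed

text \<open>The competitor is \<open>({A}, ?X)\<close>. The family \<open>?X\<close> contains both
  \<open>\<B>\<close> and the full star of \<open>T\<close>, which overlap in at most a third of
  that star; maximality makes \<open>card \<A> - 1\<close> pay for the other two thirds. The 1 is
  the retained set \<open>A\<close>.\<close>

lemma optimal_pair_degree_le:
  assumes fin: "finite H" "\<forall>A\<in>H. finite A"
    and opt: "optimal_pair (level H r) (level H s) t \<A> \<B>"
    and A: "A \<in> \<A>" "T \<subseteq> A" "card T = t"
    and few: "3 * card (star \<B> T) \<le> card (star (level H s) T)"
  shows "2 * card (star (level H s) T) \<le> 3 * (card \<A> - 1)"
proof -
  let ?X = "{B \<in> level H s. t \<le> card (A \<inter> B)}"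
  have cp: "(\<A>, \<B>) \<in> cross_pairs (level H r) (level H s) t"
    using opt by (simp add: optimal_pair_def)
  then have AH: "A \<in> level H r" and BX: "\<B> \<subseteq> ?X" and "\<B> \<noteq> {}"
    using A by (auto simp: cross_pairs_def cross_intersecting_def intersects_in_def)
  then have "({A}, ?X) \<in> cross_pairs (level H r) (level H s) t"
    by (auto simp: cross_pairs_def cross_intersecting_def intersects_in_def)
  then have "card {A} + card ?X \<le> card \<A> + card \<B>"
    using opt by (auto simp: optimal_pair_def)
  then have max: "1 + card ?X \<le> card \<A> + card \<B>" by simp
  have finX: "finite ?X" and finA: "finite A"
    using fin AH by (auto simp: level_def)
  have finT: "finite (star (level H s) T)" using fin by (auto simp: star_def level_def)
  have finB: "finite \<B>" using finX BX finite_subset by blast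
  have "t \<le> card (A \<inter> B)" if "T \<subseteq> B" for B
    using card_mono[of "A \<inter> B" T] A that finA by auto
  then have "\<B> \<union> star (level H s) T \<subseteq> ?X" using BX by (auto simp: star_def)
  then have "card (\<B> \<union> star (level H s) T) \<le> card ?X" using finX card_mono by blast
  moreover have "card \<B> + card (star (level H s) T)
      = card (\<B> \<union> star (level H s) T) + card (\<B> \<inter> star (level H s) T)"
    by (rule card_Un_Int[OF finB finT])
  moreover have "\<B> \<inter> star (level H s) T = star \<B> T"
    using BX by (auto simp: star_def)
  ultimately show ?thesis using max few by simp
qed

text \<open>The stars of the t-subsets of \<open>B\<close> cover \<open>\<A>\<close>, and the last
  two hypotheses bound each by 3K(|A| - 1)/(2N). Summing gives |A| \<le> |A| - 1, with
  \<open>\<A>\<close> nonempty. It is applied with K = 1 if r < s and K = \<open>Suc (r - t)\<close>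
  if r = s.\<close>

lemma sum_star_contradiction:
  assumes cp: "(\<A>, \<B>) \<in> cross_pairs F G t" "finite F"
    and B: "B \<in> \<B>" "finite B" "card B = s"
    and N: "3 * K * (s choose t) \<le> 2 * N" "0 < N"
    and few: "\<And>A T. A \<in> \<A> \<Longrightarrow> T \<subseteq> A \<Longrightarrow> T \<subseteq> B \<Longrightarrow> card T = t \<Longrightarrow>
      N * card (star \<A> T) \<le> K * d T"
    and degree: "\<And>A T. A \<in> \<A> \<Longrightarrow> T \<subseteq> A \<Longrightarrow> T \<subseteq> B \<Longrightarrow> card T = t \<Longrightarrow>
      2 * d T \<le> 3 * (card \<A> - 1)"
  shows False
proof -
  let ?T = "{T. T \<subseteq> B \<and> card T = t}"
  have finA: "finite \<A>" and ne: "\<A> \<noteq> {}"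
    using cp finite_subset by (auto simp: cross_pairs_def)
  have finT: "finite ?T" using B(2) by auto
  have "\<A> \<subseteq> (\<Union>T\<in>?T. star \<A> T)"
  proof
    fix A assume A: "A \<in> \<A>"
    then have "t \<le> card (A \<inter> B)"
      using cp B by (auto simp: cross_pairs_def cross_intersecting_def intersects_in_def)
    then obtain T where "T \<subseteq> A \<inter> B" "card T = t" by (rule obtain_subset_with_card_n)
    then show "A \<in> (\<Union>T\<in>?T. star \<A> T)" using A by (auto simp: star_def)
  qed
  moreover have "finite (\<Union>T\<in>?T. star \<A> T)" using finA finT by (auto simp: star_def)
  ultimately have "card \<A> \<le> card (\<Union>T\<in>?T. star \<A> T)" by (rule card_mono[rotated])
  also have "\<dots> \<le> (\<Sum>T\<in>?T. card (star \<A> T))" by (rule card_UN_le[OF finT])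
  finally have "card \<A> \<le> (\<Sum>T\<in>?T. card (star \<A> T))" .
  then have "2 * N * card \<A> \<le> 2 * N * (\<Sum>T\<in>?T. card (star \<A> T))" by simp
  also have "\<dots> = (\<Sum>T\<in>?T. 2 * (N * card (star \<A> T)))"
    by (simp add: sum_distrib_left mult.assoc)
  also have "\<dots> \<le> (\<Sum>T\<in>?T. K * (3 * (card \<A> - 1)))"
  proof (rule sum_mono)
    fix T assume T: "T \<in> ?T"
    show "2 * (N * card (star \<A> T)) \<le> K * (3 * (card \<A> - 1))"
    proof (cases "star \<A> T = {}")
      case False
      then obtain A where A: "A \<in> \<A>" "T \<subseteq> A" by (auto simp: star_def)
      then have "2 * (N * card (star \<A> T)) \<le> K * (2 * d T)" using few T by fastforce
      also have "\<dots> \<le> K * (3 * (card \<A> - 1))" using degree A T by (intro mult_left_mono) auto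
      finally show ?thesis .
    qed simp
  qed
  also have "\<dots> = (3 * K * (s choose t)) * (card \<A> - 1)"
    using n_subsets[OF B(2)] B(3) by (simp add: mult_ac)
  also have "\<dots> \<le> 2 * N * (card \<A> - 1)" using N(1) by (rule mult_right_mono) simp
  also have "\<dots> < 2 * N * card \<A>"
    using N(2) ne finA card_gt_0_iff[of \<A>] by simp
  finally show False by simp
qed

section \<open>Arithmetic extracted from the bound on the base size\<close>

lemma binomial_ge_self:
  assumes "1 \<le> t" "t < n"
  shows "n \<le> n choose t"
proof -
  have "n - 1 + 1 \<le> n choose t" using assms
  proof (induction n arbitrary: t)
    case (Suc n)
    obtain u where t: "t = Suc u" using Suc.prems by (cases t) auto
    show ?case
    proof (cases "t < n")
      case True
      then have "n \<le> n choose t" using Suc.IH[of t] Suc.prems by simp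
      moreover have "1 \<le> n choose u" using True t by (simp add: Suc_leI)
      ultimately show ?thesis by (simp add: t)
    next
      case False
      then have "t = n" using Suc.prems by simp
      then show ?thesis by simp
    qed
  qed simp
  then show ?thesis by simp
qed

text \<open>The maximum in \<open>c_bound\<close>, less one: the summand s - t given up here,
  together with t \<le> r, pays for the s in the first inequality of
  \<open>ratio_bounds\<close>.\<close>

definition ratio :: "nat \<Rightarrow> nat \<Rightarrow> nat \<Rightarrow> nat" where
  "ratio r s t = max (2 * (s choose t)) (2 ^ r * (r - t) * (r choose t) + 1) - 1"

text \<open>The first bound feeds the counting at level s - 1; the second produces the one third in
  \<open>optimal_pair_degree_le\<close>; the last two are the numerical hypothesis of
  \<open>sum_star_contradiction\<close> for its two values of K.\<close>

lemma ratio_bounds: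
  assumes "1 \<le> t" "t \<le> r" "r \<le> s" "t < s"
  shows "(s - t) * ratio r s t + s \<le> c_bound r s t"
    and "3 * Suc (r - t) \<le> ratio r s t"
    and "r < s \<Longrightarrow> 3 * (s choose t) \<le> 2 * ratio r s t"
    and "r = s \<Longrightarrow> 3 * Suc (r - t) * (s choose t) \<le> 2 * ratio r s t"
proof -
  let ?M = "max (2 * (s choose t)) (2 ^ r * (r - t) * (r choose t) + 1)"
  have s: "s \<le> s choose t" using binomial_ge_self assms by simp
  have M: "?M = Suc (ratio r s t)" by (simp add: ratio_def)
  show "(s - t) * ratio r s t + s \<le> c_bound r s t"
    unfolding c_bound_def M using assms by simp
  have N1: "2 * (s choose t) - 1 \<le> ratio r s t" by (simp add: ratio_def)
  \<comment> \<open>The factor 4 comes from 2^r with r \<ge> 2, as 1 \<le> t < r.\<close>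
  have N2: "4 * (r - t) * (r choose t) \<le> ratio r s t" if "t < r"
  proof -
    have "(2::nat) ^ 2 \<le> 2 ^ r" using that assms(1) by (intro power_increasing) auto
    then have "4 * ((r - t) * (r choose t)) \<le> 2 ^ r * ((r - t) * (r choose t))"
      by (intro mult_right_mono) auto
    then show ?thesis unfolding ratio_def mult.assoc by linarith
  qed
  \<comment> \<open>With C the binomial coefficient, 3C \<le> 2(2C - 1) holds once C \<ge> 2, and C
    \<ge> s \<ge> 2.\<close>
  show "3 * (s choose t) \<le> 2 * ratio r s t" if "r < s"
    using N1 s assms by linarith
  show "3 * Suc (r - t) \<le> ratio r s t"
  proof (cases "t < r")
    case True
    have "2 \<le> r choose t" using binomial_ge_self[of t r] True assms by linarith
    then have "4 * (r - t) * 2 \<le> 4 * (r - t) * (r choose t)" by (rule mult_left_mono) simp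
    then have "4 * (r - t) * 2 \<le> ratio r s t" using N2[OF True] by (rule order_trans)
    moreover have "1 \<le> r - t" using True by simp
    ultimately show ?thesis by simp
  next
    case False
    then show ?thesis using N1 s assms by auto
  qed
  show "3 * Suc (r - t) * (s choose t) \<le> 2 * ratio r s t" if "r = s"
  proof -
    have "3 * Suc (r - t) * (s choose t) \<le> (8 * (r - t)) * (s choose t)"
      using that assms by (intro mult_right_mono) auto
    also have "\<dots> = 2 * (4 * (r - t) * (r choose t))" using that by simp
    also have "\<dots> \<le> 2 * ratio r s t" using N2 that assms by (intro mult_left_mono) auto
    finally show ?thesis .
  qed
qed

section \<open>Case analysis on the common intersections of the two families\<close>

theorem theorem1p5:
  fixes t r s :: nat
    and H \<A> \<B> :: "'a set set"
  assumes "1 \<le> t" and "t \<le> r" and "r \<le> s"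
    and "finite H" and "\<forall>A\<in>H. finite A"
    and "hereditary H"
    and "min_base_size H \<ge> c_bound r s t"
    and "(\<A>, \<B>) \<in> max_cross_pairs (level H r) (level H s) t"
  shows "\<exists>I\<in>H. t \<le> card I \<and> card I \<le> r \<and>
    ((\<A> = star (level H r) I \<and> \<B> = {B \<in> level H s. card (B \<inter> I) \<ge> t}) \<or>
     (r = s \<and> t < card I \<and>
      \<A> = {A \<in> level H r. card (A \<inter> I) \<ge> t} \<and> \<B> = star (level H s) I))"
proof -
  note fin = \<open>finite H\<close> \<open>\<forall>A\<in>H. finite A\<close> and her = \<open>hereditary H\<close>
  note trs = \<open>1 \<le> t\<close> \<open>t \<le> r\<close> \<open>r \<le> s\<close>
  have fin_level: "finite (level H k)" for k using fin by (simp add: level_def)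
  have opt: "optimal_pair (level H r) (level H s) t \<A> \<B>"
    using optimal_pair_max_cross_pairs[OF fin_level fin_level] assms(8) .
  then have cp: "(\<A>, \<B>) \<in> cross_pairs (level H r) (level H s) t"
    by (simp add: optimal_pair_def)
  then have ne: "\<A> \<noteq> {}" "\<B> \<noteq> {}" and AH: "\<A> \<subseteq> level H r" and BH: "\<B> \<subseteq> level H s"
    and cross: "\<And>A B. A \<in> \<A> \<Longrightarrow> B \<in> \<B> \<Longrightarrow> t \<le> card (A \<inter> B)"
    by (auto simp: cross_pairs_def cross_intersecting_def intersects_in_def)
  have A: "A \<in> H" "finite A" "card A = r" if "A \<in> \<A>" for A
    using AH that fin by (auto simp: level_def)
  have B: "B \<in> H" "finite B" "card B = s" if "B \<in> \<B>" for B
    using BH that fin by (auto simp: level_def)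
  obtain A1 where A1: "A1 \<in> \<A>" using ne by blast
  obtain B1 where B1: "B1 \<in> \<B>" using ne by blast
  define I where "I = \<Inter>\<A>"
  define J where "J = \<Inter>\<B>"
  have IA: "I \<subseteq> A1" using A1 by (auto simp: I_def)
  have JB: "J \<subseteq> B1" using B1 by (auto simp: J_def)
  have IH: "I \<in> H" using A(1)[OF A1] her IA by (auto simp: hereditary_def)
  have JH: "J \<in> H" using B(1)[OF B1] her JB by (auto simp: hereditary_def)
  have finI: "finite I" and finJ: "finite J" using IH JH fin by auto
  show ?thesis
  proof (cases "\<forall>B\<in>\<B>. t \<le> card (B \<inter> I)")
    case True
    have "t \<le> card I"
      using True B1 card_mono[OF finI, of "B1 \<inter> I"] by force
    moreover have "card I \<le> r" using card_mono[OF A(2)[OF A1] IA] A(3)[OF A1] by simp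
    moreover have "\<forall>A\<in>\<A>. I \<subseteq> A" by (auto simp: I_def)
    ultimately show ?thesis
      using optimal_pair_kernel[OF fin opt _ True] IH by blast
  next
    case False
    then obtain B0 where B0: "B0 \<in> \<B>" "card (B0 \<inter> I) < t" by auto
    \<comment> \<open>If t = s, every member of \<open>\<A>\<close> would contain \<open>B0\<close>,
      so \<open>B0\<close> would lie in \<open>I\<close>, against its choice.\<close>
    have ts: "t < s"
    proof (rule ccontr)
      assume "\<not> t < s"
      then have eq: "t = s" "r = s" using trs by auto
      have "B0 \<subseteq> A" if "A \<in> \<A>" for A
      proof -
        have "A \<inter> B0 = B0"
          using card_seteq[of B0 "A \<inter> B0"] B[OF B0(1)] cross[OF that B0(1)] eq by auto
        then show ?thesis by blast
      qed
      then have "B0 \<inter> I = B0" by (auto simp: I_def)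
      then show False using B0 B[OF B0(1)] eq by simp
    qed
    define N where "N = ratio r s t"
    note N = ratio_bounds[OF trs ts, folded N_def]
    have base: "\<forall>U\<in>bases H. (s - t) * N + s \<le> card U"
    proof
      fix U assume "U \<in> bases H"
      then have "min_base_size H \<le> card U"
        unfolding min_base_size_def using fin by (intro Min_le) (auto simp: bases_def)
      then show "(s - t) * N + s \<le> card U" using N(1) assms(7) by linarith
    qed
    have Npos: "0 < N" using N(2) by simp
    let ?d = "\<lambda>T. card (star (level H s) T)"
    \<comment> \<open>At k = s - 1 the left factor in \<open>star_level_Suc\<close> is at least (s -
      t)N and the right one is s - t, which cancels.\<close>
    have pred: "N * card (star (level H (s - 1)) T) \<le> ?d T"
      if "finite T" "card T = t" for T
    proof -
      have "(s - t) * (N * card (star (level H (s - 1)) T))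
          \<le> ((s - t) * N + s - (s - 1)) * card (star (level H (s - 1)) T)"
        unfolding mult.assoc[symmetric] by (intro mult_right_mono) auto
      also have "\<dots> \<le> (s - t) * ?d T"
        using star_level_Suc[OF fin her base that(1), of "s - 1"] that(2) ts by simp
      finally show ?thesis using ts by simp
    qed
    have small: "N * card (star (level H s) (insert w T)) \<le> ?d T"
      if "finite T" "card T = t" "w \<notin> T" for w T
    proof -
      have "N * card (star (level H s) (insert w T)) \<le> N * card (star (level H (s - 1)) T)"
        using star_level_insert[OF fin her that(3), of "s - 1"] ts by simp
      also have "\<dots> \<le> ?d T" by (rule pred[OF that(1,2)])
      finally show ?thesis .
    qed
    have notI: "\<exists>A\<in>\<A>. \<not> T \<subseteq> A" if "\<not> T \<subseteq> I" for T
      using that by (auto simp: I_def)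
    have TB0: "\<not> T \<subseteq> I" if "T \<subseteq> B0" "card T = t" for T
      using card_mono[of "B0 \<inter> I" T] that B0 finI by auto
    have fewB: "N * card (star \<B> T) \<le> Suc (r - t) * ?d T"
      if T: "finite T" "card T = t" "\<not> T \<subseteq> I" for T
    proof -
      obtain A' where A': "A' \<in> \<A>" "\<not> T \<subseteq> A'" using notI T(3) by blast
      have "N * card (star \<B> T) \<le> Suc (card A' - t) * ?d T"
      proof (rule card_star_meeting[OF fin(1) T(1,2) A(2)[OF A'(1)] _ A'(2)])
        show "t \<le> card A'" using A(3)[OF A'(1)] trs by simp
        show "star \<B> T \<subseteq> star (level H s) T" using BH by (auto simp: star_def)
        show "\<forall>F\<in>star \<B> T. t \<le> card (F \<inter> A')"
          unfolding star_def using cross[OF A'(1)] by (simp add: Int_commute)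
      qed (rule small[OF T(1,2)])
      then show ?thesis using A(3)[OF A'(1)] by simp
    qed
    have third: "3 * x \<le> y" if "N * x \<le> Suc (r - t) * y" for x y
    proof -
      have "Suc (r - t) * (3 * x) = 3 * Suc (r - t) * x" by (simp only: mult_ac)
      also have "\<dots> \<le> N * x" using N(2) by (rule mult_right_mono) simp
      also note that
      finally show ?thesis by (simp only: Suc_mult_le_cancel1)
    qed
    have degree: "2 * ?d T \<le> 3 * (card \<A> - 1)"
      if "A \<in> \<A>" "T \<subseteq> A" "T \<subseteq> B0" "card T = t" for A T
    proof (rule optimal_pair_degree_le[OF fin opt that(1,2,4)])
      have "finite T" using A(2)[OF that(1)] that(2) by (rule finite_subset[rotated])
      then have "N * card (star \<B> T) \<le> Suc (r - t) * ?d T"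
        by (rule fewB[OF _ that(4) TB0[OF that(3,4)]])
      then show "3 * card (star \<B> T) \<le> ?d T" by (rule third)
    qed
    show ?thesis
    proof (cases "r < s")
      case True
      have False
      proof (rule sum_star_contradiction[OF cp fin_level B0(1) B(2,3)[OF B0(1)], where K = 1])
        show "3 * 1 * (s choose t) \<le> 2 * N" using N(3) True by simp
        \<comment> \<open>Since r \<le> s - 1, monotonicity moves the star up to level s - 1, where
          \<open>pred\<close> applies.\<close>
        show "N * card (star \<A> T) \<le> 1 * ?d T"
          if "A \<in> \<A>" "T \<subseteq> A" "T \<subseteq> B0" "card T = t" for A T
        proof -
          have T: "finite T" using A(2)[OF that(1)] that(2) by (rule finite_subset[rotated])
          have "s - t \<le> (s - t) * N" using Npos by simp
          then have "2 * (s - 1) \<le> (s - t) * N + s + card T" using that(4) by linarith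
          then have "card (star (level H r) T) \<le> card (star (level H (s - 1)) T)"
            using True by (intro star_level_mono[OF fin her base T]) auto
          moreover have "card (star \<A> T) \<le> card (star (level H r) T)"
            using AH fin_level by (intro card_mono) (auto simp: star_def)
          ultimately have "N * card (star \<A> T) \<le> N * card (star (level H (s - 1)) T)"
            by simp
          also have "\<dots> \<le> ?d T" by (rule pred[OF T that(4)])
          finally show ?thesis by simp
        qed
      qed (use Npos degree in auto)
      then show ?thesis ..
    next
      case False
      then have rs: "r = s" using trs by simp
      show ?thesis
      proof (cases "\<forall>A\<in>\<A>. t \<le> card (A \<inter> J)")
        case True
        have tJ: "t \<le> card J"
          using True A1 card_mono[OF finJ, of "A1 \<inter> J"] by force
        have Jr: "card J \<le> r" using card_mono[OF B(2)[OF B1] JB] B(3)[OF B1] rs by simp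
        have "\<forall>B\<in>\<B>. J \<subseteq> B" by (auto simp: J_def)
        then have form: "\<B> = star (level H s) J" "\<A> = {A \<in> level H r. t \<le> card (A \<inter> J)}"
          using optimal_pair_kernel[OF fin optimal_pair_swap[OF opt] _ True] by auto
        show ?thesis
        proof (cases "t < card J")
          case True
          then show ?thesis using form JH Jr tJ rs by blast
        next
          \<comment> \<open>When |J| = t, meeting \<open>J\<close> in t elements means containing
            it, so the two forms coincide and the first one holds with \<open>J\<close> as the
            witness.\<close>
          case False
          then have "card J = t" using tJ by simp
          then have "t \<le> card (A \<inter> J) \<longleftrightarrow> J \<subseteq> A" for A
            using card_seteq[OF finJ, of "A \<inter> J"] by (auto simp: Int_absorb1)
          then have "{A \<in> level H k. t \<le> card (A \<inter> J)} = star (level H k) J" for k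
            by (auto simp: star_def)
          then show ?thesis using form JH Jr tJ rs by blast
        qed
      next
        case False
        then obtain A0 where A0: "A0 \<in> \<A>" "card (A0 \<inter> J) < t" by auto
        have TA0: "\<not> T \<subseteq> J" if "T \<subseteq> A0" "card T = t" for T
          using card_mono[of "A0 \<inter> J" T] that A0 finJ by auto
        have fewA: "N * card (star \<A> T) \<le> Suc (r - t) * ?d T"
          if T: "finite T" "card T = t" "\<not> T \<subseteq> J" for T
        proof -
          obtain B' where B': "B' \<in> \<B>" "\<not> T \<subseteq> B'" using T(3) by (auto simp: J_def)
          have "N * card (star \<A> T) \<le> Suc (card B' - t) * ?d T"
          proof (rule card_star_meeting[OF fin(1) T(1,2) B(2)[OF B'(1)] _ B'(2)])
            show "t \<le> card B'" using B(3)[OF B'(1)] trs by simp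
            show "star \<A> T \<subseteq> star (level H s) T" using AH rs by (auto simp: star_def)
            show "\<forall>F\<in>star \<A> T. t \<le> card (F \<inter> B')"
              unfolding star_def using cross[OF _ B'(1)] by simp
          qed (rule small[OF T(1,2)])
          then show ?thesis using B(3)[OF B'(1)] rs by simp
        qed
        have K: "3 * Suc (r - t) * (s choose t) \<le> 2 * N" using N(4) rs by simp
        \<comment> \<open>The size of \<open>I\<close> decides which family is covered by few small
          stars: \<open>\<A>\<close> through \<open>B0\<close>, or \<open>\<B>\<close> through
          \<open>A0\<close>.\<close>
        have False
        proof (cases "t \<le> card I")
          case True
          show False
          proof (rule sum_star_contradiction[OF cp fin_level B0(1) B(2,3)[OF B0(1)] K Npos])
            show "N * card (star \<A> T) \<le> Suc (r - t) * ?d T"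
              if "A \<in> \<A>" "T \<subseteq> A" "T \<subseteq> B0" "card T = t" for A T
            proof -
              have T: "finite T" using A(2)[OF that(1)] that(2) by (rule finite_subset[rotated])
              \<comment> \<open>Otherwise |I| \<ge> t = |T| would force I = T. An element of I - T
                lies in every member of \<open>\<A>\<close>, so it enlarges the prescribed
                set.\<close>
              have "\<not> I \<subseteq> T"
                using TB0[OF that(3,4)] card_seteq[OF T, of I] True that(4) by auto
              then obtain w where w: "w \<in> I" "w \<notin> T" by blast
              have "star \<A> T \<subseteq> star (level H s) (insert w T)"
                using AH rs w(1) by (auto simp: star_def I_def)
              then have "card (star \<A> T) \<le> card (star (level H s) (insert w T))"
                using fin_level by (intro card_mono) (auto simp: star_def)
              then have "N * card (star \<A> T) \<le> N * card (star (level H s) (insert w T))"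
                by simp
              also have "\<dots> \<le> ?d T" by (rule small[OF T that(4) w(2)])
              finally show ?thesis by simp
            qed
          qed (use degree in auto)
        next
          case False
          \<comment> \<open>No t-set fits into \<open>I\<close>, so \<open>fewB\<close> covers every
            t-subset of \<open>A0\<close>; the degree bound now comes from \<open>fewA\<close> and
            the swapped pair.\<close>
          have noI: "\<not> T \<subseteq> I" if "card T = t" for T
            using False card_mono[OF finI, of T] that by auto
          have cp': "(\<B>, \<A>) \<in> cross_pairs (level H s) (level H r) t"
            by (rule cross_pairs_swap[OF cp])
          have cardA0: "card A0 = s" using A[OF A0(1)] rs by simp
          show False
          proof (rule sum_star_contradiction[OF cp' fin_level A0(1) A(2)[OF A0(1)] cardA0 K Npos])
            fix B T assume T: "B \<in> \<B>" "T \<subseteq> B" "T \<subseteq> A0" "card T = t"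
            have finT: "finite T" using B(2)[OF T(1)] T(2) by (rule finite_subset[rotated])
            show "N * card (star \<B> T) \<le> Suc (r - t) * ?d T"
              by (rule fewB[OF finT T(4) noI[OF T(4)]])
            have "N * card (star \<A> T) \<le> Suc (r - t) * ?d T"
              using fewA[OF finT T(4)] TA0[OF T(3,4)] by blast
            then have "3 * card (star \<A> T) \<le> ?d T" by (rule third)
            then show "2 * ?d T \<le> 3 * (card \<B> - 1)"
              using optimal_pair_degree_le[OF fin optimal_pair_swap[OF opt] T(1,2,4)] rs by simp
          qed
        qed
        then show ?thesis ..
      qed
    qed
  qed
qed

end
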